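(* For every integer $a\ge2$, put $q_a=e^{-2\pi/\sqrt a}$ and $\lambda_a=49e^{-4\pi\sqrt a}$. Then $T(q_a)=a^6$, every $W_{a,d}(\cdot,24)$ has no pole at $q_a$, and $$\left|W_{a,d}(q_a,24)-a^6\right|\le\frac{4q_a^{2-2a}}{1-q_a}\,\frac{\lambda_a^d}{1-\lambda_a^d}\qquad(d\ge2).$$
   Context: $\Phi(q)=\prod_{n\ge1}(1-q^n)$. For integers $a,d\ge2$ and $0<|q|<1$, $$W_{a,d}(q,24)=\frac1d\sum_{z^d=1}\frac{\sum_{m\ge0}z^mq^{am+1}\Phi(q^{am+1})^{24}}{\sum_{m\ge0}z^mq^{a(m+1)}\Phi(q^{a(m+1)})^{24}},\qquad T(q)=q^{1-a}\frac{\Phi(q)^{24}}{\Phi(q^a)^{24}},$$ with $W_{a,d}(\cdot,24)$ meromorphic in $q$ on $0<|q|<1$. *)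

theory Defs
  imports "HOL-Complex_Analysis.Complex_Analysis"
begin

definition Phi :: "complex \<Rightarrow> complex" where
  "Phi q = (\<Prod>n. 1 - q ^ Suc n)"

definition W_num :: "nat \<Rightarrow> complex \<Rightarrow> complex \<Rightarrow> complex" where
  "W_num a z q = (\<Sum>m. z ^ m * q ^ (a * m + 1) * Phi (q ^ (a * m + 1)) ^ 24)"

definition W_den :: "nat \<Rightarrow> complex \<Rightarrow> complex \<Rightarrow> complex" where
  "W_den a z q = (\<Sum>m. z ^ m * q ^ (a * (m + 1)) * Phi (q ^ (a * (m + 1))) ^ 24)"

(* As a meromorphic function, W takes its limit value at a removable singularity, for instance
   where a denominator vanishes without causing a pole; remove_sings implements this, whereas
   the bare quotient would use the convention x / 0 = 0 there. *)
definition W :: "nat \<Rightarrow> nat \<Rightarrow> complex \<Rightarrow> complex" where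
  "W a d = remove_sings (\<lambda>q. 1 / of_nat d * (\<Sum>z | z ^ d = 1. W_num a z q / W_den a z q))"

definition T :: "nat \<Rightarrow> complex \<Rightarrow> complex" where
  "T a q = q powi (1 - int a) * (Phi q ^ 24 / Phi (q ^ a) ^ 24)"

definition q_pt :: "nat \<Rightarrow> real" where
  "q_pt a = exp (- 2 * pi / sqrt (real a))"

definition lam :: "nat \<Rightarrow> real" where
  "lam a = 49 * exp (- 4 * pi * sqrt (real a))"

lemma cball_in_unit_ball:
  fixes x :: complex
  assumes "x \<in> ball 0 1"
  obtains e r where "e > 0" "cball x e \<subseteq> ball 0 1"
    "\<And>q. q \<in> cball x e \<Longrightarrow> norm q \<le> r" "r < 1"
proof
  define e where "e = (1 - norm x) / 2"
  show "e > 0" using assms by (simp add: e_def)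
  show le: "norm q \<le> norm x + e" if "q \<in> cball x e" for q
    using that norm_triangle_ineq[of x "q - x"] by (simp add: dist_norm norm_minus_commute)
  show lt: "norm x + e < 1" using assms by (simp add: e_def field_simps)
  show "cball x e \<subseteq> ball 0 1" using le lt by force
qed

lemma Phi_holomorphic: "Phi holomorphic_on ball 0 1"
proof (rule holomorphic_uniform_sequence[where f = "\<lambda>N q. \<Prod>n<N. 1 - q ^ Suc n"])
  fix x :: complex assume x: "x \<in> ball 0 1"
  obtain e r where e: "e > 0" "cball x e \<subseteq> ball 0 1"
    and r: "\<And>q. q \<in> cball x e \<Longrightarrow> norm q \<le> r" "r < 1"
    using x by (rule cball_in_unit_ball) blast
  have r0: "r \<ge> 0" using r(1)[of x] e(1) norm_ge_zero[of x] by (simp del: norm_ge_zero)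
  have "uniformly_convergent_on (cball x e) (\<lambda>N q. \<Prod>n<N. 1 - q ^ Suc n)"
  proof (rule Infinite_Products.uniformly_convergent_on_prod')
    have sum: "summable (\<lambda>n. r ^ Suc n)"
      using r r0 by (subst summable_Suc_iff) (auto intro!: summable_geometric)
    have "norm (norm ((1 - q ^ Suc n) - 1)) \<le> r ^ Suc n" if "q \<in> cball x e" for q n
      using power_mono[OF r(1)[OF that], of "Suc n"] by (simp add: norm_power norm_mult)
    from Weierstrass_m_test'[OF this sum]
    show "uniformly_convergent_on (cball x e) (\<lambda>N q. \<Sum>n<N. norm ((1 - q ^ Suc n) - 1))" .
  qed (auto intro!: continuous_intros)
  then obtain L where L: "uniform_limit (cball x e) (\<lambda>N q. \<Prod>n<N. 1 - q ^ Suc n) L sequentially"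
    by (auto simp: uniformly_convergent_on_def)
  have "L q = Phi q" if q: "q \<in> cball x e" for q
  proof -
    have nq: "norm q < 1" using q e by auto
    have "abs_convergent_prod (\<lambda>n. 1 - q ^ Suc n)"
      unfolding abs_convergent_prod_conv_summable using nq
      by (simp add: norm_mult norm_power summable_mult summable_geometric)
    hence cp: "convergent_prod (\<lambda>n. 1 - q ^ Suc n)" by (rule abs_convergent_prod_imp_convergent_prod)
    from convergent_prod_LIMSEQ[OF this]
    have "(\<lambda>N. \<Prod>n\<le>N. 1 - q ^ Suc n) \<longlonglongrightarrow> Phi q" by (simp add: Phi_def)
    moreover have "(\<lambda>N. \<Prod>n<Suc N. 1 - q ^ Suc n) \<longlonglongrightarrow> L q"
      by (rule LIMSEQ_Suc[OF tendsto_uniform_limitI[OF L q]])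
    hence "(\<lambda>N. \<Prod>n\<le>N. 1 - q ^ Suc n) \<longlonglongrightarrow> L q" by (simp only: lessThan_Suc_atMost)
    ultimately show ?thesis using LIMSEQ_unique by blast
  qed
  hence "uniform_limit (cball x e) (\<lambda>N q. \<Prod>n<N. 1 - q ^ Suc n) Phi sequentially"
    using L by (subst uniform_limit_cong'[where g = "\<lambda>N q. \<Prod>n<N. 1 - q ^ Suc n" and i = L]) auto
  thus "\<exists>d>0. cball x d \<subseteq> ball 0 1 \<and>
          uniform_limit (cball x d) (\<lambda>N q. \<Prod>n<N. 1 - q ^ Suc n) Phi sequentially"
    using e by blast
qed (auto intro!: holomorphic_intros)

(* Both series defining W are instances of this one. *)
lemma series_holomorphic:
  fixes z :: complex and k :: "nat \<Rightarrow> nat"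
  assumes z: "norm z = 1" and k: "\<And>m. m < k m"
  shows "(\<lambda>q. \<Sum>m. z ^ m * q ^ k m * Phi (q ^ k m) ^ 24) holomorphic_on ball 0 1"
proof (rule holomorphic_uniform_sequence[where
    f = "\<lambda>N q. \<Sum>m<N. z ^ m * q ^ k m * Phi (q ^ k m) ^ 24"])
  have "norm (q ^ k m) < 1" if "norm q < 1" for q :: complex and m
    using that k[of m] power_less_one_iff[of "norm q" "k m"] by (auto simp: norm_power)
  hence im: "(\<lambda>q. q ^ k m) ` ball 0 1 \<subseteq> ball (0::complex) 1" for m by auto
  have "(Phi \<circ> (\<lambda>q. q ^ k m)) holomorphic_on ball 0 1" for m
    by (rule holomorphic_on_compose_gen[OF _ Phi_holomorphic im]) (auto intro!: holomorphic_intros)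
  thus "(\<lambda>q. \<Sum>m<N. z ^ m * q ^ k m * Phi (q ^ k m) ^ 24) holomorphic_on ball 0 1" for N
    by (auto intro!: holomorphic_intros simp: o_def)
next
  fix x :: complex assume x: "x \<in> ball 0 1"
  obtain e r where e: "e > 0" "cball x e \<subseteq> ball 0 1"
    and r: "\<And>q. q \<in> cball x e \<Longrightarrow> norm q \<le> r" "r < 1"
    using x by (rule cball_in_unit_ball) blast
  have r0: "r \<ge> 0" using r(1)[of x] e(1) norm_ge_zero[of x] by (simp del: norm_ge_zero)
  have "cball (0::complex) r \<subseteq> ball 0 1" using r by auto
  hence "continuous_on (cball 0 r) Phi"
    using Phi_holomorphic holomorphic_on_imp_continuous_on continuous_on_subset by blast
  hence "bounded (Phi ` cball 0 r)" by (intro compact_imp_bounded compact_continuous_image) auto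
  then obtain C where C: "\<And>q. q \<in> cball 0 r \<Longrightarrow> norm (Phi q) \<le> C"
    unfolding bounded_iff by blast
  have "norm (z ^ m * q ^ k m * Phi (q ^ k m) ^ 24) \<le> r ^ m * C ^ 24" if q: "q \<in> cball x e" for q m
  proof -
    have nq: "norm q \<le> r" "norm q \<le> 1" using r(1)[OF q] r(2) by auto
    have "norm (q ^ k m) \<le> norm q ^ Suc m"
      using k[of m] nq(2) by (simp only: norm_power) (rule power_decreasing, auto)
    also have "\<dots> \<le> r ^ Suc m" using nq by (intro power_mono) auto
    finally have *: "norm (q ^ k m) \<le> r ^ Suc m" .
    have "r ^ Suc m \<le> r" using r0 r(2) power_decreasing[of 1 "Suc m" r] by simp
    hence "norm (Phi (q ^ k m)) \<le> C" using * by (intro C) auto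
    hence "norm (Phi (q ^ k m)) ^ 24 \<le> C ^ 24" by (intro power_mono) auto
    moreover have "norm (q ^ k m) \<le> r ^ m"
      using * power_decreasing[of m "Suc m" r] r0 r(2) by simp
    ultimately show ?thesis using z r0
      by (auto simp: norm_mult norm_power intro!: mult_mono)
  qed
  moreover have "summable (\<lambda>m. r ^ m * C ^ 24)"
    using r0 r(2) by (intro summable_mult2 summable_geometric) auto
  ultimately have "uniform_limit (cball x e) (\<lambda>N q. \<Sum>m<N. z ^ m * q ^ k m * Phi (q ^ k m) ^ 24)
      (\<lambda>q. \<Sum>m. z ^ m * q ^ k m * Phi (q ^ k m) ^ 24) sequentially"
    by (rule Weierstrass_m_test)
  thus "\<exists>d>0. cball x d \<subseteq> ball 0 1 \<and>
      uniform_limit (cball x d) (\<lambda>N q. \<Sum>m<N. z ^ m * q ^ k m * Phi (q ^ k m) ^ 24)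
      (\<lambda>q. \<Sum>m. z ^ m * q ^ k m * Phi (q ^ k m) ^ 24) sequentially"
    using e by blast
qed auto

lemma W_nicely_meromorphic:
  assumes "a \<ge> 2" "d \<ge> 2"
  shows "W a d nicely_meromorphic_on {q. 0 < norm q \<and> norm q < 1}"
proof -
  have less: "m < a * m + 1" "m < a * (m + 1)" for m
    using assms mult_le_mono1[of 1 a m] by (simp_all only: add_mult_distrib2) linarith+
  have *: "(\<lambda>q. W_num a z q / W_den a z q) meromorphic_on ball 0 1" if "z ^ d = 1" for z
  proof -
    have z: "norm z = 1" using power_eq_1_iff[OF that] assms by auto
    have mero: "f meromorphic_on ball 0 1" if "f holomorphic_on ball 0 1" for f
      using that by (simp add: analytic_on_imp_meromorphic_on analytic_on_open)
    show ?thesis unfolding W_num_def W_den_def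
      by (intro meromorphic_on_divide mero series_holomorphic z less)
  qed
  have "(\<lambda>q. 1 / of_nat d * (\<Sum>z | z ^ d = 1. W_num a z q / W_den a z q)) meromorphic_on ball 0 1"
    by (intro meromorphic_on_mult meromorphic_on_sum * meromorphic_on_const) auto
  hence "W a d nicely_meromorphic_on ball 0 1"
    unfolding W_def by (rule remove_sings_nicely_meromorphic)
  thus ?thesis by (rule nicely_meromorphic_on_subset) auto
qed

end

theory Submission
  imports Defs
begin

text \<open>
  Write \<open>\<Delta>(y) = y \<Phi>(y)^24\<close> and \<open>x = q^a\<close>. Up to the common factor \<open>1 - z x\<close>, which is cleared, the quotient
  averaged in \<open>W\<close> is a ratio \<open>F(z)\<close> of two power series in \<open>z\<close> that converge for \<open>|z| < x^{-2}\<close>, and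
  \<open>F(0) = \<Delta>(q) / \<Delta>(x) = T(q)\<close>. Since \<open>0 \<le> y - \<Delta>(y) \<le> 24 y^2 / (1 - y)\<close>, for \<open>x \<le> 1/1000\<close> the cleared
  denominator has no zero in the disc \<open>|z| \<le> 1 / (49 x^2)\<close>, and \<open>|F| \<le> 4 q^2 / (x^2 (1 - q))\<close> there.
  The average over the \<open>d\<close>-th roots of unity keeps exactly the Taylor coefficients of \<open>F\<close> whose index
  is a multiple of \<open>d\<close>, and Cauchy's inequality bounds all but the constant one.

  At \<open>q_a\<close> the value of \<open>T\<close> comes from \<open>\<Delta>(-1/\<tau>) = \<tau>^12 \<Delta>(\<tau>)\<close> on the imaginary axis. The Lambert series of
  \<open>ln \<Phi>\<close> and the partial fractions of \<open>coth\<close> turn \<open>ln \<Phi>(e^{-2 \<pi> t})\<close> into a conditionally convergent sum of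
  \<open>t / (k^2 t^2 + m^2)\<close>, a term invariant under \<open>t \<mapsto> 1/t\<close>, \<open>k \<leftrightarrow> m\<close>. The parts outside the square
  \<open>k, m \<le> K\<close> are Riemann sums of \<open>arctan s / s\<close> and differ in the limit by \<open>\<pi>/2 ln t\<close>.
\<close>

section \<open>Partial fractions of the hyperbolic cotangent\<close>

text \<open>Logarithmic derivative of \<open>Gamma z * Gamma (1 - z) = pi / sin (pi * z)\<close>;
  the shift from \<open>Digamma z\<close> to \<open>Digamma (1 + z)\<close> contributes
  \<open>1 / z\<close>.\<close>

lemma Digamma_reflection:
  fixes z :: complex
  assumes "z \<notin> \<int>"
  shows "Digamma (1 - z) - Digamma (1 + z) = of_real pi * cot (of_real pi * z) - 1 / z"
proof -
  have z: "z \<noteq> 0" "z \<notin> \<int>\<^sub>\<le>\<^sub>0" using assms nonpos_Ints_subset_Ints by auto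
  have z1: "1 - z \<notin> \<int>\<^sub>\<le>\<^sub>0"
    using assms nonpos_Ints_Int[of "1 - z"] by (metis Ints_1 Ints_diff diff_diff_eq2 add_diff_cancel_left' nonpos_Ints_subset_Ints subsetD)
  \<comment> \<open>This product is constant only off the integers, hence the neighbourhood of
    \<open>z\<close> avoiding them; its derivative at \<open>z\<close> is then 0.\<close>
  let ?f = "\<lambda>w::complex. sin (of_real pi * w) * (Gamma w * Gamma (1 - w))"
  have sin_nz: "sin (of_real pi * w) \<noteq> 0" if "w \<notin> \<int>" for w :: complex
    using that by (auto simp: sin_eq_0 elim!: Ints_cases)
  have "\<forall>\<^sub>F w in nhds z. w \<in> - \<int>"
    using assms closed_of_int_image[of UNIV] by (intro eventually_nhds_in_open) (auto simp: Ints_def open_closed)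
  hence ev: "\<forall>\<^sub>F w in nhds z. ?f w = of_real pi"
    by eventually_elim (simp add: Gamma_reflection_complex sin_nz)
  have "(?f has_field_derivative 0) (at z)"
    using DERIV_cong_ev[OF refl ev refl, of 0] by simp
  moreover have "(?f has_field_derivative
      (of_real pi * cos (of_real pi * z) * (Gamma z * Gamma (1 - z)) +
      sin (of_real pi * z) * (Gamma z * Digamma z * Gamma (1 - z) - Gamma z * (Gamma (1 - z) * Digamma (1 - z))))) (at z)"
    using z z1 by (auto intro!: derivative_eq_intros simp: algebra_simps)
  ultimately have "of_real pi * cos (of_real pi * z) * (Gamma z * Gamma (1 - z)) +
      sin (of_real pi * z) * (Gamma z * Digamma z * Gamma (1 - z) - Gamma z * (Gamma (1 - z) * Digamma (1 - z))) = 0"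
    by (rule DERIV_unique[rotated])
  hence "(Gamma z * Gamma (1 - z)) * (of_real pi * cos (of_real pi * z) 
       + sin (of_real pi * z) * (Digamma z - Digamma (1 - z))) = 0"
    by (simp add: algebra_simps)
  moreover have "Gamma z * Gamma (1 - z) \<noteq> 0" using z z1 by (simp add: Gamma_eq_zero_iff)
  ultimately have "of_real pi * cos (of_real pi * z) 
       + sin (of_real pi * z) * (Digamma z - Digamma (1 - z)) = 0" by simp
  hence "Digamma (1 - z) - Digamma z = of_real pi * cot (of_real pi * z)"
    using sin_nz[OF assms] by (simp add: cot_def field_simps add_eq_0_iff)
  thus ?thesis using Digamma_plus1[OF z(1)] by (simp add: add.commute algebra_simps)
qed

text \<open>This is coth in the form whose fraction with denominator \<open>exp (2 * y) - 1\<close>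
  later becomes a Lambert summand.\<close>

lemma cot_imaginary:
  fixes y :: real
  assumes "y > 0"
  shows "cot (\<i> * of_real y) = - \<i> * of_real (1 + 2 / (exp (2 * y) - 1))"
proof -
  have e1: "exp (2 * y) \<noteq> 1" using assms by simp
  note e = e1 exp_double[of y] e1[unfolded exp_double]
  have "cot (\<i> * of_real y) = \<i> * (exp (- y) + exp y) / (exp (-y) - exp y)"
    by (simp add: cot_def cos_exp_eq sin_exp_eq exp_of_real[symmetric] divide_simps)
  also have "\<dots> = \<i> * of_real ((exp (- y) + exp y) / (exp (-y) - exp y))"
    by simp
  also have "(exp (- y) + exp y) / (exp (-y) - exp y) = - (1 + 2 / (exp (2 * y) - 1))"
    using assms e by (simp add: exp_minus divide_simps power2_eq_square algebra_simps)
  finally show ?thesis by (simp only: of_real_minus mult_minus_left mult_minus_right)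
qed

text \<open>The Digamma series at \<open>1 - z\<close> and \<open>1 + z\<close> with
  \<open>z = i y\<close> are subtracted: Euler's constant and the terms \<open>1 / (m + 1)\<close>
  cancel, and conjugate fractions combine.\<close>

lemma coth_partial_fractions:
  fixes y :: real
  assumes "y > 0"
  shows "(\<lambda>m. y / (y\<^sup>2 + (real (Suc m))\<^sup>2)) sums (pi / (exp (2 * pi * y) - 1) + pi / 2 - 1 / (2 * y))"
proof -
  define z where "z = \<i> * of_real y"
  have zZ: "z \<notin> \<int>" using assms by (auto simp: z_def Ints_def complex_eq_iff)
  have nz: "1 + z \<noteq> 0" "1 - z \<noteq> 0" using assms by (auto simp: z_def complex_eq_iff)
  have "(\<lambda>m. inverse (of_nat (Suc m)) - inverse (w + of_nat m)) sums (Digamma w + euler_mascheroni)"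
    if "w \<noteq> 0" for w :: complex
    using summable_sums[OF summable_Digamma[OF that]] by (simp add: Digamma_def)
  from sums_diff[OF this[OF nz(2)] this[OF nz(1)]]
  have "(\<lambda>m. inverse (1 + z + of_nat m) - inverse (1 - z + of_nat m)) sums
     (of_real pi * cot (of_real pi * z) - 1 / z)"
    by (simp add: Digamma_reflection[OF zZ, symmetric])
  also have "(\<lambda>m. inverse (1 + z + of_nat m) - inverse (1 - z + of_nat m)) =
     (\<lambda>m. - 2 * \<i> * of_real (y / (y\<^sup>2 + (real (Suc m))\<^sup>2)))"
  proof
    fix m
    have 1: "1 + z + of_nat m \<noteq> 0" "1 - z + of_nat m \<noteq> 0"
      using assms by (auto simp: z_def complex_eq_iff)
    have 2: "(1 + z + of_nat m) * (1 - z + of_nat m) = of_real (y\<^sup>2 + (real (Suc m))\<^sup>2)"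
      by (simp add: z_def complex_eq_iff algebra_simps power2_eq_square)
    have "inverse (1 + z + of_nat m) - inverse (1 - z + of_nat m) = - 2 * z / ((1 + z + of_nat m) * (1 - z + of_nat m))"
      using 1 by (simp add: divide_simps)
    thus "inverse (1 + z + of_nat m) - inverse (1 - z + of_nat m) = - 2 * \<i> * of_real (y / (y\<^sup>2 + (real (Suc m))\<^sup>2))"
      unfolding 2 by (simp add: z_def)
  qed
  also have "of_real pi * cot (of_real pi * z) - 1 / z =
     - 2 * \<i> * of_real (pi / (exp (2 * pi * y) - 1) + pi / 2 - 1 / (2 * y))"
  proof -
    have "of_real pi * z = \<i> * of_real (pi * y)" by (simp add: z_def)
    moreover have "1 / z = - \<i> * of_real (1 / y)" using assms by (simp add: z_def divide_simps)
    moreover have "cot (\<i> * of_real (pi * y)) = - \<i> * of_real (1 + 2 / (exp (2 * pi * y) - 1))"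
      using cot_imaginary[of "pi * y"] assms by (simp add: mult.assoc)
    ultimately have "of_real pi * cot (of_real pi * z) - 1 / z =
        of_real pi * (- \<i> * of_real (1 + 2 / (exp (2 * pi * y) - 1))) - (- \<i> * of_real (1 / y))"
      by (simp only:)
    thus ?thesis by (simp add: ring_distribs)
  qed
  finally have "(\<lambda>m. of_real (y / (y\<^sup>2 + (real (Suc m))\<^sup>2)) :: complex) sums of_real (pi / (exp (2 * pi * y) - 1) + pi / 2 - 1 / (2 * y))"
    by (subst (asm) sums_mult_iff) auto
  thus ?thesis by (simp only: sums_of_real_iff)
qed

section \<open>The logarithm of the Euler function\<close>

definition ln_Phi :: "real \<Rightarrow> real" where
  "ln_Phi y = (\<Sum>n. ln (1 - y ^ Suc n))"

lemma summable_ln_Phi: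
  fixes y :: real
  assumes "0 \<le> y" "y < 1"
  shows "summable (\<lambda>n. ln (1 - y ^ Suc n))"
proof (rule summable_comparison_test')
  show "summable (\<lambda>n. y ^ n * (y / (1 - y)))"
    using assms by (intro summable_mult2 summable_geometric) auto
  fix n
  have w: "0 \<le> y ^ Suc n" "y ^ Suc n \<le> y" "y ^ Suc n < 1"
    using assms power_decreasing[of 1 "Suc n" y] by (auto simp del: power_Suc)
  have "- ln (1 - y ^ Suc n) = ln (inverse (1 - y ^ Suc n))" using w by (simp add: ln_inverse)
  also have "\<dots> \<le> inverse (1 - y ^ Suc n) - 1" using w by (intro ln_le_minus_one) simp
  also have "\<dots> = y ^ Suc n / (1 - y ^ Suc n)" using w by (simp add: field_simps)
  also have "\<dots> \<le> y ^ Suc n / (1 - y)" using w assms by (intro divide_left_mono) auto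
  finally show "norm (ln (1 - y ^ Suc n)) \<le> y ^ n * (y / (1 - y))"
    using w by (simp add: mult.commute)
qed

text \<open>On \<open>[0, 1)\<close> every factor is positive, so the product is the exponential of
  a real series.\<close>

lemma Phi_of_real:
  assumes "0 \<le> y" "y < 1"
  shows "Phi (of_real y) = of_real (exp (ln_Phi y))"
proof -
  have "y ^ Suc n < 1" for n
    using assms power_decreasing[of 1 "Suc n" y] by (auto simp del: power_Suc)
  hence "exp (of_real (ln (1 - y ^ Suc n))) = 1 - (of_real y :: complex) ^ Suc n" for n
    by (simp add: exp_of_real del: power_Suc)
  hence "Phi (of_real y) = prodinf (\<lambda>n. exp (of_real (ln (1 - y ^ Suc n))))"
    by (simp add: Phi_def)
  also have "\<dots> = exp (of_real (ln_Phi y))"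
    unfolding ln_Phi_def using summable_ln_Phi[OF assms]
    by (subst prodinf_exp) (auto simp: summable_of_real suminf_of_real)
  finally show ?thesis by (simp add: exp_of_real)
qed

text \<open>Each logarithm expands into the sum of \<open>y ^ (n * k) / k\<close> over
  \<open>k\<close>. All terms are nonnegative, so the order of summation may be exchanged, and the
  sum over \<open>n\<close> is geometric.\<close>

lemma ln_Phi_Lambert_series:
  assumes "0 < y" "y < 1"
  shows "(\<lambda>k. y ^ Suc k / (real (Suc k) * (1 - y ^ Suc k))) sums (- ln_Phi y)"
proof -
  let ?f = "\<lambda>(n, k). y ^ (Suc n * Suc k) / real (Suc k)"
  have yk: "0 \<le> y ^ Suc k" "y ^ Suc k < 1" for k
    using assms power_decreasing[of 1 "Suc k" y] by (auto simp del: power_Suc)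
  have row: "((\<lambda>k. ?f (n, k)) has_sum - ln (1 - y ^ Suc n)) UNIV" for n
  proof -
    have "\<bar>- (y ^ Suc n)\<bar> < 1" using yk[of n] by (simp del: power_Suc)
    from sums_minus[OF ln_series'[OF this]]
    have "(\<lambda>k. (y ^ Suc n) ^ k / real k) sums (- ln (1 - y ^ Suc n))"
      by (simp del: power_Suc)
    hence "(\<lambda>k. (y ^ Suc n) ^ Suc k / real (Suc k)) sums (- ln (1 - y ^ Suc n))"
      by (subst sums_Suc_iff) simp
    hence "(\<lambda>k. ?f (n, k)) sums (- ln (1 - y ^ Suc n))"
      by (simp only: power_mult case_prod_conv)
    thus ?thesis by (rule sums_nonneg_imp_has_sum) (use assms in simp)
  qed
  have col: "((\<lambda>n. ?f (n, k)) has_sum (y ^ Suc k / (real (Suc k) * (1 - y ^ Suc k)))) UNIV" for k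
  proof -
    have "(\<lambda>n. (y ^ Suc k) ^ n) sums (1 / (1 - y ^ Suc k))"
      using yk[of k] by (intro geometric_sums) simp
    note sums_mult[OF this, of "y ^ Suc k / real (Suc k)"]
    also have "(\<lambda>n. y ^ Suc k / real (Suc k) * (y ^ Suc k) ^ n) = (\<lambda>n. ?f (n, k))"
    proof
      fix n
      have "y ^ (Suc n * Suc k) = (y ^ Suc k) ^ Suc n"
        by (simp only: mult.commute[of "Suc n"] power_mult)
      thus "y ^ Suc k / real (Suc k) * (y ^ Suc k) ^ n = ?f (n, k)"
        by (simp only: power_Suc case_prod_conv times_divide_eq_left)
    qed
    finally have "(\<lambda>n. ?f (n, k)) sums (y ^ Suc k / (real (Suc k) * (1 - y ^ Suc k)))"
      by (simp only: times_divide_times_eq mult_1_right)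
    thus ?thesis by (rule sums_nonneg_imp_has_sum) (use assms in simp)
  qed
  have S: "((\<lambda>n. - ln (1 - y ^ Suc n)) has_sum - ln_Phi y) UNIV"
    using summable_sums[OF summable_ln_Phi[of y]] assms yk unfolding ln_Phi_def
    by (intro sums_nonneg_imp_has_sum sums_minus) (auto simp del: power_Suc)
  have "?f summable_on UNIV \<times> UNIV"
    by (rule summable_on_SigmaI[OF row]) (use S assms in \<open>auto simp: summable_on_def\<close>)
  hence "(?f has_sum - ln_Phi y) (UNIV \<times> UNIV)"
    by (rule has_sum_SigmaI[OF row S])
  hence "((\<lambda>(k, n). ?f (n, k)) has_sum - ln_Phi y) (UNIV \<times> UNIV)"
    by (subst (asm) has_sum_swap) simp
  hence "((\<lambda>k. y ^ Suc k / (real (Suc k) * (1 - y ^ Suc k))) has_sum - ln_Phi y) UNIV"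
    by (rule has_sum_SigmaD) (use col in auto)
  thus ?thesis by (rule has_sum_imp_sums)
qed

section \<open>The modular transformation on the imaginary axis\<close>

text \<open>The Eisenstein summand \<open>Im tau / |k tau + m|^2\<close> at
  \<open>tau = i t\<close>.\<close>

definition lattice_term :: "real \<Rightarrow> nat \<Rightarrow> nat \<Rightarrow> real" where
  "lattice_term t k m = t / ((real k * t)\<^sup>2 + (real m)\<^sup>2)"

lemma lattice_term_inverse:
  assumes "t > 0"
  shows "lattice_term (1 / t) m k = lattice_term t k m"
proof -
  have "(real m * (1 / t))\<^sup>2 + (real k)\<^sup>2 = ((real k * t)\<^sup>2 + (real m)\<^sup>2) / t\<^sup>2"
    using assms by (simp add: field_simps)
  thus ?thesis by (simp add: lattice_term_def power2_eq_square)
qed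

text \<open>This antiderivative vanishes at infinity, so an integral over a tail is read off at its
  lower end.\<close>

lemma DERIV_arctan_inverse:
  fixes c v :: real
  assumes "v > 0" "c > 0"
  shows "((\<lambda>v. - arctan (c / v)) has_real_derivative c / (c\<^sup>2 + v\<^sup>2)) (at v)"
proof -
  have "((\<lambda>v. - arctan (c / v)) has_real_derivative - ((1 / (1 + (c / v)\<^sup>2)) * (- c / (v * v)))) (at v)"
    using assms by (auto intro!: derivative_eq_intros simp: divide_inverse)
  also have "- ((1 / (1 + (c / v)\<^sup>2)) * (- c / (v * v))) = c / (c\<^sup>2 + v\<^sup>2)"
    using assms by (simp add: divide_simps power2_eq_square add_nonneg_eq_0_iff)
  finally show ?thesis .
qed

lemma summable_lattice_term: "t > 0 \<Longrightarrow> k > 0 \<Longrightarrow> summable (\<lambda>m. lattice_term t k (m + j))"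
proof -
  assume t: "t > 0" "k > 0"
  have "(\<lambda>m. 1 / (real k) * (real k * t / ((real k * t)\<^sup>2 + (real (Suc m))\<^sup>2))) sums
     (1 / real k * (pi / (exp (2 * pi * (real k * t)) - 1) + pi / 2 - 1 / (2 * (real k * t))))"
    by (intro sums_mult coth_partial_fractions) (use t in auto)
  moreover have "(\<lambda>m. 1 / (real k) * (real k * t / ((real k * t)\<^sup>2 + (real (Suc m))\<^sup>2))) = (\<lambda>m. lattice_term t k (Suc m))"
    using t by (auto simp: lattice_term_def)
  ultimately have "summable (\<lambda>m. lattice_term t k (Suc m))" by (auto simp: sums_iff)
  hence "summable (lattice_term t k)" by (subst (asm) summable_Suc_iff)
  thus ?thesis by (rule summable_ignore_initial_segment)
qed

text \<open>Comparison with the integral of \<open>t / (k^2 t^2 + v^2)\<close> over \<open>v \<ge> M\<close>.\<close>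

lemma lattice_tail_bounds:
  assumes "t > 0" "k > 0" "M > 0"
  defines "S \<equiv> (\<Sum>m. lattice_term t k (m + Suc M))"
  shows "S \<le> arctan (real k * t / real M) / real k"
    and "arctan (real k * t / real M) / real k - t / (real M)\<^sup>2 \<le> S"
proof -
  define g where "g v = - arctan (real k * t / v) / real k" for v
  \<comment> \<open>The integrand decreases, so its integral over \<open>[m, m + 1]\<close> lies
    between neighbouring terms.\<close>
  have mvt: "lattice_term t k (Suc m) \<le> g (real (Suc m)) - g (real m)"
            "g (real (Suc m)) - g (real m) \<le> lattice_term t k m" if "m > 0" for m
  proof -
    have "\<exists>z>real m. z < real (Suc m) \<and> g (real (Suc m)) - g (real m) =
      (real (Suc m) - real m) * (real k * t / ((real k * t)\<^sup>2 + z\<^sup>2) / real k)"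
      unfolding g_def using that assms
      by (intro MVT2 DERIV_cdivide DERIV_arctan_inverse) auto
    then obtain z where z: "real m < z" "z < real (Suc m)"
      and gz: "g (real (Suc m)) - g (real m) = t / ((real k * t)\<^sup>2 + z\<^sup>2)"
      using assms by auto
    have pos: "0 < (real k * t)\<^sup>2" using assms by simp
    show "lattice_term t k (Suc m) \<le> g (real (Suc m)) - g (real m)"
      unfolding gz lattice_term_def using z assms pos
      by (intro divide_left_mono add_left_mono power_mono mult_pos_pos add_pos_nonneg) auto
    show "g (real (Suc m)) - g (real m) \<le> lattice_term t k m"
      unfolding gz lattice_term_def using z assms pos
      by (intro divide_left_mono add_left_mono power_mono mult_pos_pos add_pos_nonneg) auto
  qed
  have "(\<lambda>m. real k * t / real (m + M)) \<longlonglongrightarrow> 0"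
    using LIMSEQ_ignore_initial_segment[OF lim_const_over_n[of "real k * t"], of M] by simp
  hence "(\<lambda>m. g (real (m + M))) \<longlonglongrightarrow> - arctan 0 / real k"
    unfolding g_def using assms by (intro tendsto_intros) auto
  from telescope_sums[OF this]
  have tel: "(\<lambda>m. g (real (Suc (m + M))) - g (real (m + M))) sums (arctan (real k * t / real M) / real k)"
    by (simp add: g_def)
  have s: "(\<lambda>m. lattice_term t k (Suc (m + M))) sums S"
    using summable_sums[OF summable_lattice_term[of t k "Suc M"]] assms by simp
  show "S \<le> arctan (real k * t / real M) / real k"
  proof (rule sums_le[OF _ s tel])
    show "lattice_term t k (Suc (m + M)) \<le> g (real (Suc (m + M))) - g (real (m + M))" for m
      using mvt(1)[of "m + M"] assms(3) by linarith
  qed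
  \<comment> \<open>The lower bound compares with the sum started at \<open>M\<close> instead of
    \<open>M + 1\<close>; the extra term is the loss of at most \<open>t / M^2\<close>.\<close>
  have "(\<lambda>m. lattice_term t k (m + M)) sums (S + lattice_term t k M)"
    using s sums_Suc_iff[of "\<lambda>m. lattice_term t k (m + M)" S] by simp
  note sum_M = this
  have "arctan (real k * t / real M) / real k \<le> S + lattice_term t k M"
  proof (rule sums_le[OF _ tel sum_M])
    show "g (real (Suc (m + M))) - g (real (m + M)) \<le> lattice_term t k (m + M)" for m
      using mvt(2)[of "m + M"] assms(3) by linarith
  qed
  moreover have "lattice_term t k M \<le> t / (real M)\<^sup>2"
    unfolding lattice_term_def using assms by (intro divide_left_mono) (auto intro!: mult_pos_pos add_nonneg_pos)
  ultimately show "arctan (real k * t / real M) / real k - t / (real M)\<^sup>2 \<le> S" by linarith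
qed

text \<open>On each cell the mean value theorem writes the increment of \<open>A\<close> as width
  times a value of \<open>f\<close>; uniform continuity moves that value to the right
  endpoint.\<close>

lemma Riemann_sum_tendsto:
  fixes f A :: "real \<Rightarrow> real"
  assumes t: "t > 0" and cont: "continuous_on {0..t} f"
    and A: "\<And>x. x \<in> {0..t} \<Longrightarrow> (A has_real_derivative f x) (at x within {0..t})"
  shows "(\<lambda>K. \<Sum>k=1..K. t / real K * f (real k * t / real K)) \<longlonglongrightarrow> A t - A 0"
proof (rule LIMSEQ_I)
  fix r :: real assume r: "r > 0"
  \<comment> \<open>The cells have total length \<open>t\<close>, so the total error is at most
    \<open>t * e = r / 2\<close>.\<close>
  define e where "e = r / (2 * t)"
  have e: "e > 0" using r t by (simp add: e_def)
  have "uniformly_continuous_on {0..t} f" using cont by (rule compact_uniformly_continuous) simp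
  then obtain d where d: "d > 0"
    and fd: "\<And>x y. x \<in> {0..t} \<Longrightarrow> y \<in> {0..t} \<Longrightarrow> \<bar>y - x\<bar> < d \<Longrightarrow> \<bar>f y - f x\<bar> < e"
    using e unfolding uniformly_continuous_on_def dist_real_def by metis
  obtain N where N: "real N > t / d" using reals_Archimedean2 by blast
  show "\<exists>no. \<forall>K\<ge>no. norm ((\<Sum>k=1..K. t / real K * f (real k * t / real K)) - (A t - A 0)) < r"
  proof (intro exI allI impI)
    fix K assume K: "K \<ge> Suc N"
    have K0: "real K > 0" "t / real K < d" using K N d by (auto simp: field_simps intro: less_le_trans)
    let ?x = "\<lambda>k. real k * t / real K"
    have step: "\<bar>t / real K * f (?x (Suc k)) - (A (?x (Suc k)) - A (?x k))\<bar> \<le> t / real K * e"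
      if "k < K" for k
    proof -
      have "real (Suc k) * t \<le> real K * t" using that t by (intro mult_right_mono) auto
      hence le: "?x k < ?x (Suc k)" "0 \<le> ?x k" "?x (Suc k) \<le> t" "?x (Suc k) - ?x k = t / real K"
        using t K0 by (auto simp: field_simps)
      have "\<exists>z\<in>{?x k<..<?x (Suc k)}. A (?x (Suc k)) - A (?x k) = (\<lambda>h. f z * h) (?x (Suc k) - ?x k)"
      proof (rule mvt_simple[OF le(1)])
        fix z assume "?x k \<le> z" "z \<le> ?x (Suc k)"
        hence "(A has_real_derivative f z) (at z within {?x k..?x (Suc k)})"
          using le by (intro DERIV_subset[OF A]) auto
        thus "(A has_derivative (\<lambda>h. f z * h)) (at z within {?x k..?x (Suc k)})"
          by (simp add: has_field_derivative_def)
      qed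
      then obtain z where z: "?x k < z" "z < ?x (Suc k)" "A (?x (Suc k)) - A (?x k) = f z * (t / real K)"
        unfolding le(4) by auto
      have "\<bar>f (?x (Suc k)) - f z\<bar> < e" using z le K0 by (intro fd) auto
      hence "t / real K * \<bar>f (?x (Suc k)) - f z\<bar> \<le> t / real K * e"
        using t K0 by (intro mult_left_mono) auto
      thus ?thesis unfolding z(3) using t K0
        by (simp add: abs_mult[of "t / real K", symmetric] right_diff_distrib mult.commute abs_mult)
          (simp add: right_diff_distrib[symmetric] left_diff_distrib[symmetric] abs_mult abs_divide diff_divide_distrib[symmetric])
    qed
    have "A t - A 0 = (\<Sum>k<K. A (?x (Suc k)) - A (?x k))"
      using K0 by (subst sum_lessThan_telescope) simp
    moreover have "(\<Sum>k=1..K. t / real K * f (?x k)) = (\<Sum>k<K. t / real K * f (?x (Suc k)))"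
      by (simp add: sum.atLeast1_atMost_eq)
    ultimately have "\<bar>(\<Sum>k=1..K. t / real K * f (?x k)) - (A t - A 0)\<bar> =
       \<bar>\<Sum>k<K. t / real K * f (?x (Suc k)) - (A (?x (Suc k)) - A (?x k))\<bar>"
      by (simp only: sum_subtractf)
    also have "\<dots> \<le> (\<Sum>k<K. t / real K * e)"
      by (rule order_trans[OF sum_abs sum_mono]) (use step in auto)
    also have "\<dots> = r / 2" using K0 t by (simp add: e_def field_simps)
    finally show "norm ((\<Sum>k=1..K. t / real K * f (?x k)) - (A t - A 0)) < r" using r by simp
  qed
qed

text \<open>The right-endpoint Riemann sum of \<open>arctan s / s\<close> on \<open>[0, t]\<close>
  with \<open>K\<close> cells: at \<open>s = k t / K\<close> the width \<open>t / K\<close> divided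
  by \<open>s\<close> is \<open>1 / k\<close>.\<close>

definition arctan_sum :: "real \<Rightarrow> nat \<Rightarrow> real" where
  "arctan_sum t K = (\<Sum>k=1..K. arctan (real k * t / real K) / real k)"

text \<open>If \<open>A\<close> is the integral of \<open>arctan s / s\<close> from 0, then
  \<open>A t - A (1 / t)\<close> vanishes at 1 and has derivative
  \<open>(arctan t + arctan (1 / t)) / t = pi / (2 t)\<close>.\<close>

lemma arctan_sum_diff_tendsto:
  assumes "t > 0"
  shows "(\<lambda>K. arctan_sum t K - arctan_sum (1 / t) K) \<longlonglongrightarrow> pi / 2 * ln t"
proof -
  \<comment> \<open>The value 1 at 0 makes \<open>g\<close> continuous; the convention
    \<open>x / 0 = 0\<close> would not.\<close>
  define g :: "real \<Rightarrow> real" where "g s = (if s = 0 then 1 else arctan s / s)" for s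
  have g: "isCont g s" for s
  proof (cases "s = 0")
    case True
    have "((\<lambda>s. (arctan s - arctan 0) / (s - 0)) \<longlongrightarrow> 1) (at 0)"
      using DERIV_arctan[of 0] by (simp add: has_field_derivative_iff)
    hence "(g \<longlongrightarrow> 1) (at 0)"
      by (rule Lim_transform_eventually) (auto simp: g_def eventually_at_filter)
    thus ?thesis using True by (simp add: isCont_def g_def)
  next
    case False
    have "\<forall>\<^sub>F s in nhds s. s \<noteq> 0" using False by (rule t1_space_nhds)
    hence "\<forall>\<^sub>F s in nhds s. g s = arctan s / s" by eventually_elim (simp add: g_def)
    moreover have "isCont (\<lambda>s. arctan s / s) s" using False by (intro continuous_intros) auto
    ultimately show ?thesis by (simp add: isCont_cong)
  qed
  define A where "A t = integral {0..t} g" for t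
  have A: "(A has_real_derivative g x) (at x within {0..B})" if "x \<in> {0..B}" for x B
    unfolding A_def using that g
    by (intro integral_has_real_derivative) (auto intro!: continuous_at_imp_continuous_on)
  have A': "(A has_real_derivative g x) (at x)" if "x > 0" for x
    using A[of x "x + 1"] that at_within_Icc_at[of 0 x "x + 1"] by auto
  have lim: "(\<lambda>K. arctan_sum t K) \<longlonglongrightarrow> A t" if t: "t > 0" for t
  proof -
    have "(\<lambda>K. \<Sum>k=1..K. t / real K * g (real k * t / real K)) \<longlonglongrightarrow> A t - A 0"
      by (intro Riemann_sum_tendsto A t continuous_at_imp_continuous_on ballI g)
    also have "(\<lambda>K. \<Sum>k=1..K. t / real K * g (real k * t / real K)) = arctan_sum t"
      unfolding arctan_sum_def using t
      by (intro ext sum.cong) (auto simp: g_def)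
    finally show ?thesis by (simp add: A_def)
  qed
  have "A t - A (1 / t) - pi / 2 * ln t = A 1 - A (1 / 1) - pi / 2 * ln 1"
  \<comment> \<open>Any open interval of positive reals containing \<open>t\<close> and 1 serves
    here.\<close>
  proof (rule DERIV_isconst3[of "min t 1 / 2" "max t 1 + 1" t 1 "\<lambda>s. A s - A (1 / s) - pi / 2 * ln s"])
    fix s assume "s \<in> {min t 1 / 2<..<max t 1 + 1}"
    hence s: "s > 0" using assms by (auto simp: min_def split: if_splits)
    have "((\<lambda>s. A (1 / s)) has_real_derivative g (1 / s) * (- 1 / (s * s))) (at s)"
      using s by (intro DERIV_chain2[OF A']) (auto intro!: derivative_eq_intros)
    hence "((\<lambda>s. A s - A (1 / s) - pi / 2 * ln s) has_real_derivative
        g s - g (1 / s) * (- 1 / (s * s)) - pi / 2 * (1 / s)) (at s)"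
      using s by (intro DERIV_diff A' DERIV_cmult) (auto intro!: derivative_eq_intros)
    moreover have "g s - g (1 / s) * (- 1 / (s * s)) - pi / 2 * (1 / s) = 0"
      using s arctan_inverse[of s] by (simp add: g_def field_simps)
    ultimately show "((\<lambda>s. A s - A (1 / s) - pi / 2 * ln s) has_real_derivative 0) (at s)"
      by simp
  qed (use assms in auto)
  hence eq: "A t - A (1 / t) = pi / 2 * ln t" by simp
  have "0 < 1 / t" using assms by simp
  from tendsto_diff[OF lim[OF assms] lim[OF this]] show ?thesis unfolding eq .
qed

text \<open>Each sum over \<open>k\<close> alone grows like \<open>pi / 2\<close> times the harmonic
  sum. In the difference the squares cancel by symmetry, and the tails \<open>m > K\<close> approach
  their arctangent sums with error \<open>O(1 / K)\<close>.\<close>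

lemma lattice_sum_diff_tendsto:
  assumes t: "t > 0"
  shows "(\<lambda>K. (\<Sum>k=1..K. \<Sum>m. lattice_term t k (Suc m)) - (\<Sum>k=1..K. \<Sum>m. lattice_term (1 / t) k (Suc m)))
     \<longlonglongrightarrow> pi / 2 * ln t"
proof -
  define tail where "tail t K = (\<Sum>k=1..K. \<Sum>m. lattice_term t k (m + Suc K))" for t K
  define sq where "sq t K = (\<Sum>k=1..K. \<Sum>m=1..K. lattice_term t k m)" for t K
  have split: "(\<Sum>k=1..K. \<Sum>m. lattice_term t k (Suc m)) = sq t K + tail t K" if "t > 0" for t K
  proof -
    have "(\<Sum>m. lattice_term t k (Suc m)) = (\<Sum>m=1..K. lattice_term t k m) + (\<Sum>m. lattice_term t k (m + Suc K))"
      if "k > 0" for k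
      using suminf_split_initial_segment[OF summable_lattice_term[of t k 1], of K] \<open>t > 0\<close> that
      by (simp add: sum.atLeast1_atMost_eq add.commute)
    thus ?thesis unfolding sq_def tail_def sum.distrib[symmetric] by (intro sum.cong) auto
  qed
  have tail: "(\<lambda>K. tail t K - arctan_sum t K) \<longlonglongrightarrow> 0" if "t > 0" for t
  proof (rule Lim_null_comparison)
    show "(\<lambda>K. t / real K) \<longlonglongrightarrow> 0" by (rule lim_const_over_n)
    show "\<forall>\<^sub>F K in sequentially. norm (tail t K - arctan_sum t K) \<le> t / real K"
      using eventually_gt_at_top[of 0]
    proof eventually_elim
      case (elim K)
      have "\<bar>(\<Sum>m. lattice_term t k (m + Suc K)) - arctan (real k * t / real K) / real k\<bar> \<le> t / (real K)\<^sup>2"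
        if "k \<in> {1..K}" for k
        using lattice_tail_bounds[of t k K] elim \<open>t > 0\<close> that by (auto simp: abs_le_iff)
      hence "\<bar>tail t K - arctan_sum t K\<bar> \<le> (\<Sum>k=1..K. t / (real K)\<^sup>2)"
        unfolding tail_def arctan_sum_def sum_subtractf[symmetric]
        by (rule order_trans[OF sum_abs sum_mono])
      also have "\<dots> = t / real K" using elim by (simp add: power2_eq_square)
      finally show ?case by simp
    qed
  qed
  have sq_inv: "sq (1 / t) K = sq t K" for K
    unfolding sq_def using lattice_term_inverse[OF t] by (subst sum.swap) simp
  hence eq: "(\<lambda>K. (\<Sum>k=1..K. \<Sum>m. lattice_term t k (Suc m)) - (\<Sum>k=1..K. \<Sum>m. lattice_term (1 / t) k (Suc m))) =
     (\<lambda>K. (tail t K - arctan_sum t K) - (tail (1 / t) K - arctan_sum (1 / t) K) + (arctan_sum t K - arctan_sum (1 / t) K))"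
  proof (intro ext)
    fix K
    have t': "0 < 1 / t" using t by simp
    show "(\<Sum>k=1..K. \<Sum>m. lattice_term t k (Suc m)) - (\<Sum>k=1..K. \<Sum>m. lattice_term (1 / t) k (Suc m)) =
     (tail t K - arctan_sum t K) - (tail (1 / t) K - arctan_sum (1 / t) K) + (arctan_sum t K - arctan_sum (1 / t) K)"
      unfolding split[OF t] split[OF t'] sq_inv by linarith
  qed
  have "(\<lambda>K. (tail t K - arctan_sum t K) - (tail (1 / t) K - arctan_sum (1 / t) K) + (arctan_sum t K - arctan_sum (1 / t) K))
     \<longlonglongrightarrow> 0 - 0 + pi / 2 * ln t"
    using t by (intro tendsto_add tendsto_diff tail arctan_sum_diff_tendsto) auto
  thus ?thesis unfolding eq by simp
qed

text \<open>The coth expansion at \<open>k * t\<close> is solved for the Lambert summand. The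
  lattice and harmonic parts diverge separately, so all parts stay under one limit.\<close>

lemma ln_Phi_tendsto:
  assumes t: "t > 0"
  shows "(\<lambda>K. (\<Sum>k=1..K. \<Sum>m. lattice_term t k (Suc m)) / pi +
           (\<Sum>k=1..K. 1 / (real k)\<^sup>2) / (2 * pi * t) - (\<Sum>k=1..K. 1 / real k) / 2)
         \<longlonglongrightarrow> - ln_Phi (exp (- 2 * pi * t))"
proof -
  define y where "y = exp (- 2 * pi * t)"
  have y: "0 < y" "y < 1" using t by (auto simp: y_def)
  have summand: "y ^ k / (real k * (1 - y ^ k)) =
     (\<Sum>m. lattice_term t k (Suc m)) / pi + 1 / (real k)\<^sup>2 / (2 * pi * t) - 1 / real k / 2" if "k > 0" for k
  proof -
    let ?u = "real k * t"
    have "(\<lambda>m. 1 / (real k) * (?u / (?u\<^sup>2 + (real (Suc m))\<^sup>2))) sums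
       (1 / real k * (pi / (exp (2 * pi * ?u) - 1) + pi / 2 - 1 / (2 * ?u)))"
      by (intro sums_mult coth_partial_fractions) (use t that in auto)
    moreover have "(\<lambda>m. 1 / (real k) * (?u / (?u\<^sup>2 + (real (Suc m))\<^sup>2))) = (\<lambda>m. lattice_term t k (Suc m))"
      using t that by (auto simp: lattice_term_def)
    ultimately have S: "(\<Sum>m. lattice_term t k (Suc m)) =
       1 / real k * (pi / (exp (2 * pi * ?u) - 1) + pi / 2 - 1 / (2 * ?u))" by (simp add: sums_iff)
    have "y ^ k = 1 / exp (2 * pi * ?u)"
      by (simp add: y_def exp_of_nat_mult[symmetric] inverse_eq_divide[symmetric] exp_minus[symmetric] mult.assoc mult.left_commute)
    moreover have E: "exp (2 * pi * ?u) > 1" using t that by simp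
    moreover have "1 / E / (r * (1 - 1 / E)) = 1 / (r * (E - 1))" if "E > 1" for E r :: real
      using that by (simp add: divide_simps)
    ultimately have "y ^ k / (real k * (1 - y ^ k)) = 1 / (real k * (exp (2 * pi * ?u) - 1))"
      by metis
    also have "\<dots> = (\<Sum>m. lattice_term t k (Suc m)) / pi + 1 / (real k)\<^sup>2 / (2 * pi * t) - 1 / real k / 2"
      unfolding S using t that E by (simp add: divide_simps power2_eq_square) (simp add: algebra_simps)
    finally show ?thesis .
  qed
  have "(\<lambda>K. \<Sum>k<K. y ^ Suc k / (real (Suc k) * (1 - y ^ Suc k))) \<longlonglongrightarrow> - ln_Phi y"
    using ln_Phi_Lambert_series[OF y] by (simp add: sums_def)
  also have "(\<lambda>K. \<Sum>k<K. y ^ Suc k / (real (Suc k) * (1 - y ^ Suc k))) =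
     (\<lambda>K. \<Sum>k=1..K. y ^ k / (real k * (1 - y ^ k)))"
    by (simp add: sum.atLeast1_atMost_eq)
  also have "\<dots> = (\<lambda>K. (\<Sum>k=1..K. \<Sum>m. lattice_term t k (Suc m)) / pi +
           (\<Sum>k=1..K. 1 / (real k)\<^sup>2) / (2 * pi * t) - (\<Sum>k=1..K. 1 / real k) / 2)"
    by (simp add: summand sum.distrib sum_subtractf sum_divide_distrib)
  finally show ?thesis by (simp add: y_def)
qed

text \<open>This is the logarithm of \<open>eta(i / t) = sqrt t * eta(i t)\<close>. Subtracting the
  limits at \<open>t\<close> and \<open>1 / t\<close> removes the harmonic sums, and the inverse
  squares contribute \<open>pi^2 / 6\<close>.\<close>

lemma ln_Phi_modular:
  assumes t: "t > 0"
  shows "ln_Phi (exp (- 2 * pi / t)) - ln_Phi (exp (- 2 * pi * t)) = ln t / 2 + pi / 12 * (1 / t - t)"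
proof -
  have sq: "(\<lambda>K. \<Sum>k=1..K. 1 / (real k)\<^sup>2) \<longlonglongrightarrow> pi\<^sup>2 / 6"
    using inverse_squares_sums by (simp add: sums_def sum.atLeast1_atMost_eq add.commute)
  let ?L = "\<lambda>t K. \<Sum>k=1..K. \<Sum>m. lattice_term t k (Suc m)"
  have "(\<lambda>K. (?L t K - ?L (1 / t) K) / pi + (\<Sum>k=1..K. 1 / (real k)\<^sup>2) * (1 / (2 * pi * t) - t / (2 * pi)))
     \<longlonglongrightarrow> (pi / 2 * ln t) / pi + (pi\<^sup>2 / 6) * (1 / (2 * pi * t) - t / (2 * pi))"
    by (intro tendsto_intros lattice_sum_diff_tendsto sq t) auto
  moreover have "(\<lambda>K. (?L t K - ?L (1 / t) K) / pi + (\<Sum>k=1..K. 1 / (real k)\<^sup>2) * (1 / (2 * pi * t) - t / (2 * pi)))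
     \<longlonglongrightarrow> - ln_Phi (exp (- 2 * pi * t)) - (- ln_Phi (exp (- 2 * pi * (1 / t))))"
  proof -
    have "0 < 1 / t" using t by simp
    note lim = tendsto_diff[OF ln_Phi_tendsto[OF t] ln_Phi_tendsto[OF this]]
    have "L / pi + Z / (2 * pi * t) - h - (M / pi + Z / (2 * pi * (1 / t)) - h) =
       (L - M) / pi + Z * (1 / (2 * pi * t) - t / (2 * pi))" for L M Z h :: real
      using t by (simp add: field_simps)
    from lim[unfolded this] show ?thesis .
  qed
  ultimately have "- ln_Phi (exp (- 2 * pi * t)) - (- ln_Phi (exp (- 2 * pi * (1 / t)))) =
     (pi / 2 * ln t) / pi + (pi\<^sup>2 / 6) * (1 / (2 * pi * t) - t / (2 * pi))"
    using LIMSEQ_unique by blast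
  also have "\<dots> = ln t / 2 + pi / 12 * (1 / t - t)"
    using t by (simp add: field_simps power2_eq_square)
  finally show ?thesis by simp
qed

section \<open>Averages over roots of unity\<close>

text \<open>Multiplication by a primitive root \<open>w\<close> permutes the roots and multiplies
  the sum by \<open>w ^ k\<close>, which differs from 1 unless \<open>d\<close> divides
  \<open>k\<close>.\<close>

lemma sum_power_roots_unity:
  assumes "d > 0"
  shows "(\<Sum>z::complex | z ^ d = 1. z ^ k) = (if d dvd k then of_nat d else 0)"
proof (cases "d dvd k")
  case True
  then obtain j where "k = d * j" by blast
  hence "(\<Sum>z::complex | z ^ d = 1. z ^ k) = (\<Sum>z::complex | z ^ d = 1. 1)"
    by (intro sum.cong) (auto simp: power_mult)
  thus ?thesis using True card_roots_unity_eq[OF assms] by simp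
next
  case False
  define w where "w = cis (2 * pi / real d)"
  have wd: "w ^ d = 1" using assms by (simp add: w_def Complex.DeMoivre)
  have w0: "w \<noteq> 0" by (simp add: w_def)
  have wk: "w ^ k \<noteq> 1"
  proof
    assume "w ^ k = 1"
    hence "cos (2 * pi * real k / real d) = 1"
      by (simp add: w_def Complex.DeMoivre complex_eq_iff mult_ac)
    then obtain n :: int where "2 * pi * real k / real d = of_int n * 2 * pi"
      by (auto simp: cos_one_2pi_int)
    hence "real k = of_int n * real d" using assms by (simp add: field_simps)
    hence "of_int (int k) = (of_int (n * int d) :: real)" by simp
    hence "int k = n * int d" by (simp only: of_int_eq_iff)
    thus False using False by (metis dvd_triv_right int_dvd_int_iff)
  qed
  have "bij_betw ((*) w) {z. z ^ d = 1} {z. z ^ d = 1}"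
    by (rule bij_betwI[of _ _ _ "\<lambda>z. z / w"]) (auto simp: power_mult_distrib power_divide wd w0)
  hence "(\<Sum>z::complex | z ^ d = 1. z ^ k) = (\<Sum>z | z ^ d = 1. (w * z) ^ k)"
    by (rule sum.reindex_bij_betw[symmetric])
  also have "\<dots> = w ^ k * (\<Sum>z | z ^ d = 1. z ^ k)"
    by (simp add: power_mult_distrib sum_distrib_left)
  finally show ?thesis using wk False by simp
qed

text \<open>\<open>R > 1\<close> puts the roots of unity inside the disc of the Taylor series. The
  surviving coefficients at \<open>d * j\<close> with \<open>j > 0\<close> are dominated by a
  geometric series of ratio \<open>(1 / R) ^ d\<close>.\<close>

lemma roots_unity_average_bound:
  fixes f :: "complex \<Rightarrow> complex"
  assumes R: "R > 1" and d: "d > 0"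
    and hol: "f holomorphic_on ball 0 R" and cont: "continuous_on (cball 0 R) f"
    and bound: "\<And>z. norm z = R \<Longrightarrow> norm (f z) \<le> C"
  shows "norm (1 / of_nat d * (\<Sum>z | z ^ d = 1. f z) - f 0) \<le> C * ((1 / R) ^ d / (1 - (1 / R) ^ d))"
proof -
  define c where "c k = (deriv ^^ k) f 0 / fact k" for k
  have c: "norm (c k) \<le> C * (1 / R) ^ k" for k
  proof -
    have "norm ((deriv ^^ k) f 0) \<le> fact k * C / R ^ k"
      using R by (intro Cauchy_inequality hol cont bound) auto
    thus ?thesis by (simp add: c_def norm_divide power_divide field_simps)
  qed
  have c0: "c 0 = f 0" by (simp add: c_def)
  have sums: "(\<lambda>k. c k * z ^ k) sums f z" if "z ^ d = 1" for z
    using holomorphic_power_series[OF hol, of z] power_eq_1_iff[OF that] R d by (simp add: c_def)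
  have "(\<lambda>k. 1 / of_nat d * (\<Sum>z | z ^ d = 1. c k * z ^ k)) sums (1 / of_nat d * (\<Sum>z | z ^ d = 1. f z))"
    by (intro sums_mult sums_sum sums) auto
  also have "(\<lambda>k. 1 / of_nat d * (\<Sum>z | z ^ d = 1. c k * z ^ k)) = (\<lambda>k. if d dvd k then c k else 0)"
    using d by (auto simp: sum_distrib_left[symmetric] sum_power_roots_unity)
  \<comment> \<open>The always true condition is the shape in which reindexing along
    \<open>j\<close> to \<open>d * j\<close> leaves the summand.\<close>
  finally have "(\<lambda>j. if d dvd (d * j) then c (d * j) else 0) sums (1 / of_nat d * (\<Sum>z | z ^ d = 1. f z))"
    using d by (subst sums_mono_reindex) (auto simp: strict_mono_def)
  hence "(\<lambda>j. c (d * j)) sums (1 / of_nat d * (\<Sum>z | z ^ d = 1. f z))" by simp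
  hence s: "(\<lambda>j. c (d * Suc j)) sums (1 / of_nat d * (\<Sum>z | z ^ d = 1. f z) - f 0)"
    by (subst sums_Suc_iff[of "\<lambda>j. c (d * j)"]) (simp add: c0)
  define r where "r = (1 / R) ^ d"
  have r: "0 < r" "r < 1" using R d by (auto simp: r_def power_one_over power_less_one_iff one_less_power divide_less_eq)
  have "(\<lambda>j. C * r * r ^ j) sums (C * r * (1 / (1 - r)))"
    using r by (intro sums_mult geometric_sums) auto
  hence g: "(\<lambda>j. C * (1 / R) ^ (d * Suc j)) sums (C * (r / (1 - r)))"
    by (simp only: power_mult r_def power_Suc mult.assoc times_divide_eq_right mult_1_right)
  have n: "norm (c (d * Suc j)) \<le> C * (1 / R) ^ (d * Suc j)" for j by (rule c)
  have "norm (\<Sum>j. c (d * Suc j)) \<le> (\<Sum>j. C * (1 / R) ^ (d * Suc j))"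
    using g n by (intro norm_suminf_le) (auto simp: sums_iff)
  thus ?thesis using s g by (simp add: sums_iff r_def)
qed

section \<open>Generating functions of the discriminant\<close>

definition Delta :: "real \<Rightarrow> real" where
  "Delta y = y * exp (ln_Phi y) ^ 24"

text \<open>For the lower bound, induction shows that a partial product of the factors
  \<open>1 - y ^ n\<close> is at least 1 minus the partial sum of the \<open>y ^ n\<close>.\<close>

lemma exp_ln_Phi_bounds:
  assumes "0 < y" "y < 1"
  shows "exp (ln_Phi y) \<le> 1" "1 - y / (1 - y) \<le> exp (ln_Phi y)"
proof -
  have yk: "0 \<le> y ^ Suc k" "y ^ Suc k < 1" for k
    using assms power_decreasing[of 1 "Suc k" y] by (auto simp del: power_Suc)
  have s: "summable (\<lambda>n. ln (1 - y ^ Suc n))" using assms by (intro summable_ln_Phi) auto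
  have "ln_Phi y \<le> (\<Sum>n. 0)"
    unfolding ln_Phi_def by (intro suminf_le s) (use yk in \<open>auto simp del: power_Suc\<close>)
  thus "exp (ln_Phi y) \<le> 1" by simp
  have "(\<lambda>N. exp (\<Sum>n<N. ln (1 - y ^ Suc n))) \<longlonglongrightarrow> exp (ln_Phi y)"
    unfolding ln_Phi_def by (intro tendsto_exp summable_LIMSEQ s)
  moreover have "(\<lambda>N. 1 - (\<Sum>n<N. y * y ^ n)) \<longlonglongrightarrow> 1 - y * (1 / (1 - y))"
    using sums_mult[OF geometric_sums[of y], of y] assms
    by (intro tendsto_diff tendsto_const) (simp add: sums_def)
  moreover have "1 - (\<Sum>n<N. y * y ^ n) \<le> exp (\<Sum>n<N. ln (1 - y ^ Suc n))" for N
  proof (induction N)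
    case (Suc N)
    let ?P = "exp (\<Sum>n<N. ln (1 - y ^ Suc n))"
    have "?P \<le> exp 0" by (subst exp_le_cancel_iff, rule sum_nonpos) (use yk in \<open>auto simp del: power_Suc\<close>)
    hence "?P * y ^ Suc N \<le> 1 * y ^ Suc N" using yk by (intro mult_right_mono) (auto simp del: power_Suc)
    moreover have "exp (\<Sum>n<Suc N. ln (1 - y ^ Suc n)) = ?P * (1 - y ^ Suc N)"
      using yk[of N] by (simp add: exp_add del: power_Suc)
    ultimately show ?case using Suc by (simp add: algebra_simps)
  qed simp
  ultimately have "1 - y * (1 / (1 - y)) \<le> exp (ln_Phi y)"
    by (meson LIMSEQ_le)
  thus "1 - y / (1 - y) \<le> exp (ln_Phi y)" by simp
qed

lemma Delta_bounds:
  assumes "0 < y" "y < 1"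
  shows "0 < Delta y" "Delta y \<le> y" "y - Delta y \<le> 24 * y\<^sup>2 / (1 - y)"
proof -
  let ?p = "exp (ln_Phi y)" let ?s = "y / (1 - y)"
  note p = exp_ln_Phi_bounds[OF assms]
  show "0 < Delta y" using assms by (simp add: Delta_def)
  have "?p ^ 24 \<le> 1" using p by (intro power_le_one) auto
  thus "Delta y \<le> y" using assms mult_left_mono[of "?p ^ 24" 1 y] by (simp add: Delta_def)
  have "1 - 24 * ?s \<le> ?p ^ 24"
  \<comment> \<open>Bernoulli and monotonicity of the power need \<open>1 - ?s\<close> nonnegative;
    otherwise the left side is negative.\<close>
  proof (cases "?s \<le> 1")
    case True
    have "1 + real 24 * (- ?s) \<le> (1 + - ?s) ^ 24" by (intro Bernoulli_inequality) (use True in simp)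
    also have "\<dots> \<le> ?p ^ 24" using True p by (intro power_mono) auto
    finally show ?thesis by simp
  next
    case False
    hence "1 - 24 * ?s \<le> 0" by linarith
    also have "0 \<le> ?p ^ 24" by simp
    finally show ?thesis .
  qed
  hence "y * (1 - 24 * ?s) \<le> Delta y" unfolding Delta_def using assms by (intro mult_left_mono) auto
  moreover have "y * (1 - 24 * ?s) = y - 24 * y\<^sup>2 / (1 - y)"
    by (simp add: algebra_simps power2_eq_square)
  ultimately show "y - Delta y \<le> 24 * y\<^sup>2 / (1 - y)" by linarith
qed

lemma Phi_Delta:
  assumes "0 < y" "y < 1"
  shows "of_real y * Phi (of_real y) ^ 24 = of_real (Delta y)"
  using Phi_of_real[of y] assms by (simp add: Delta_def)

section \<open>Power series in \<open>z\<close> and their extension past the unit disc\<close>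

definition Delta_gen :: "real \<Rightarrow> real \<Rightarrow> complex \<Rightarrow> complex" where
  "Delta_gen y x z = (\<Sum>m. of_real (Delta (y * x ^ m)) * z ^ m)"

text \<open>\<open>cleared_gen y x\<close> is \<open>(1 - z x)\<close> times \<open>Delta_gen y x\<close>: the factor cancels the pole at \<open>z = 1/x\<close>.\<close>

definition cleared_coeff :: "real \<Rightarrow> real \<Rightarrow> nat \<Rightarrow> real" where
  "cleared_coeff y x m = Delta (y * x ^ m) - (if m = 0 then 0 else x * Delta (y * x ^ (m - 1)))"

definition cleared_gen :: "real \<Rightarrow> real \<Rightarrow> complex \<Rightarrow> complex" where
  "cleared_gen y x z = (\<Sum>m. of_real (cleared_coeff y x m) * z ^ m)"

context
  fixes x y :: real
  assumes x: "0 < x" "x < 1" and y: "0 < y" "y < 1"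
begin

lemma scaled_argument: "0 < y * x ^ m" "y * x ^ m \<le> y" "y * x ^ m < 1"
proof -
  show "0 < y * x ^ m" using x y by simp
  show "y * x ^ m \<le> y" using x y by (intro mult_left_le power_le_one) auto
  thus "y * x ^ m < 1" using y by linarith
qed

text \<open>The closed unit disc contains the roots of unity, and \<open>Delta_gen\<close> converges
  there by comparison with \<open>y * x ^ m\<close>.\<close>

lemma cleared_gen_eq:
  assumes "norm z \<le> 1"
  shows "cleared_gen y x z = (1 - z * of_real x) * Delta_gen y x z"
proof -
  let ?D = "\<lambda>m. of_real (Delta (y * x ^ m)) :: complex"
  have "summable (\<lambda>m. ?D m * z ^ m)"
  proof (rule summable_comparison_test')
    show "summable (\<lambda>m. y * x ^ m)" using x by (intro summable_mult summable_geometric) auto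
    fix m
    have "norm (?D m * z ^ m) \<le> norm (?D m) * 1"
      unfolding norm_mult norm_power using assms by (intro mult_left_mono power_le_one) auto
    also have "\<dots> \<le> y * x ^ m" using Delta_bounds(1,2)[of "y * x ^ m"] scaled_argument by simp
    finally show "norm (?D m * z ^ m) \<le> y * x ^ m" .
  qed
  hence s: "(\<lambda>m. ?D m * z ^ m) sums Delta_gen y x z" by (simp add: Delta_gen_def summable_sums)
  hence "(\<lambda>m. ?D (Suc m) * z ^ Suc m) sums (Delta_gen y x z - ?D 0)"
    by (subst sums_Suc_iff[of "\<lambda>m. ?D m * z ^ m"]) simp
  from sums_diff[OF this sums_mult[OF s, of "z * of_real x"]]
  have "(\<lambda>m. of_real (cleared_coeff y x (Suc m)) * z ^ Suc m) sums
      (Delta_gen y x z - ?D 0 - z * of_real x * Delta_gen y x z)"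
    by (simp add: cleared_coeff_def algebra_simps)
  from this[THEN sums_Suc_iff[of "\<lambda>m. of_real (cleared_coeff y x m) * z ^ m", THEN iffD1]]
  show ?thesis by (simp add: cleared_gen_def sums_iff cleared_coeff_def algebra_simps)
qed

text \<open>The linear parts of \<open>Delta (y * x ^ Suc m)\<close> and
  \<open>x * Delta (y * x ^ m)\<close> cancel. The quadratic errors remain, so the coefficients
  decay like \<open>x ^ (2 * m)\<close>.\<close>

lemma cleared_coeff_bound:
  "\<bar>cleared_coeff y x (Suc m)\<bar> \<le> 24 * y\<^sup>2 / (1 - y) * (1 + x) * x * (x\<^sup>2) ^ m"
proof -
  define f where "f w = w - Delta w" for w
  have f: "0 \<le> f (y * x ^ k)" "f (y * x ^ k) \<le> 24 * y\<^sup>2 / (1 - y) * (x ^ k)\<^sup>2" for k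
  proof -
    note s = scaled_argument[of k]
    show "0 \<le> f (y * x ^ k)" using Delta_bounds(2)[of "y * x ^ k"] s by (simp add: f_def)
    have "f (y * x ^ k) \<le> 24 * (y * x ^ k)\<^sup>2 / (1 - y * x ^ k)"
      using Delta_bounds(3)[of "y * x ^ k"] s by (simp add: f_def)
    also have "\<dots> \<le> 24 * (y * x ^ k)\<^sup>2 / (1 - y)"
      using s y by (intro divide_left_mono) auto
    finally show "f (y * x ^ k) \<le> 24 * y\<^sup>2 / (1 - y) * (x ^ k)\<^sup>2" by (simp add: power_mult_distrib)
  qed
  have "cleared_coeff y x (Suc m) = x * f (y * x ^ m) - f (y * x ^ Suc m)"
    by (simp add: cleared_coeff_def f_def algebra_simps)
  also have "\<bar>\<dots>\<bar> \<le> x * f (y * x ^ m) + f (y * x ^ Suc m)"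
    using f(1)[of m] f(1)[of "Suc m"] x mult_nonneg_nonneg[of x "f (y * x ^ m)"] by linarith
  also have "\<dots> \<le> x * (24 * y\<^sup>2 / (1 - y) * (x ^ m)\<^sup>2) + 24 * y\<^sup>2 / (1 - y) * (x ^ Suc m)\<^sup>2"
    by (rule add_mono[OF mult_left_mono[OF f(2)] f(2)]) (use x in simp)
  also have "\<dots> = 24 * y\<^sup>2 / (1 - y) * (x * (x ^ m)\<^sup>2 + (x ^ Suc m)\<^sup>2)"
    by (simp only: distrib_left mult.left_commute)
  also have "x * (x ^ m)\<^sup>2 + (x ^ Suc m)\<^sup>2 = (1 + x) * x * (x\<^sup>2) ^ m"
    by (simp add: power_mult[symmetric] mult.commute[of 2] power_mult_distrib power2_eq_square algebra_simps)
  finally show ?thesis by (simp only: mult.assoc)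
qed

lemma cleared_term_bound:
  "norm (of_real (cleared_coeff y x (Suc m)) * z ^ Suc m) \<le>
     24 * y\<^sup>2 / (1 - y) * (1 + x) * x * norm z * (x\<^sup>2 * norm z) ^ m" for z :: complex
proof -
  have "norm (of_real (cleared_coeff y x (Suc m)) * z ^ Suc m) = \<bar>cleared_coeff y x (Suc m)\<bar> * norm z ^ Suc m"
    by (simp only: norm_mult norm_power norm_of_real)
  also have "\<dots> \<le> 24 * y\<^sup>2 / (1 - y) * (1 + x) * x * (x\<^sup>2) ^ m * norm z ^ Suc m"
    by (intro mult_right_mono cleared_coeff_bound) auto
  finally show ?thesis by (simp add: power_mult_distrib mult_ac)
qed

lemma cleared_gen_sums:
  assumes "x\<^sup>2 * norm z < 1"
  shows "(\<lambda>m. of_real (cleared_coeff y x m) * z ^ m) sums cleared_gen y x z"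
proof -
  have "summable (\<lambda>m. of_real (cleared_coeff y x (Suc m)) * z ^ Suc m)"
    using assms
    by (intro summable_comparison_test'[OF _ cleared_term_bound] summable_mult summable_geometric) auto
  hence "summable (\<lambda>m. of_real (cleared_coeff y x m) * z ^ m)"
    by (subst (asm) summable_Suc_iff)
  thus ?thesis by (simp add: cleared_gen_def summable_sums)
qed

lemma cleared_gen_holomorphic: "cleared_gen y x holomorphic_on ball 0 (1 / x\<^sup>2)"
proof (rule power_series_holomorphic[where a = "\<lambda>m. of_real (cleared_coeff y x m)"])
  fix w :: complex assume "w \<in> ball 0 (1 / x\<^sup>2)"
  hence "x\<^sup>2 * norm w < 1" using x by (simp add: field_simps)
  from cleared_gen_sums[OF this]
  show "(\<lambda>m. of_real (cleared_coeff y x m) * (w - 0) ^ m) sums cleared_gen y x w" by simp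
qed

text \<open>The constant 49 is chosen so that 24 times the geometric sum
  \<open>(1 / 49) / (1 - 1 / 49)\<close> is exactly \<open>1 / 2\<close>.\<close>

lemma cleared_gen_bound:
  assumes z: "norm z \<le> 1 / (49 * x\<^sup>2)"
  shows "norm (cleared_gen y x z - of_real (Delta y)) \<le> (1 + x) / 2 * (y\<^sup>2 / ((1 - y) * x))"
proof -
  let ?K = "24 * y\<^sup>2 / (1 - y) * (1 + x) * x"
  have K: "?K \<ge> 0" using x y by simp
  have r: "x\<^sup>2 * norm z \<le> 1 / 49" using z x by (simp add: field_simps)
  have t: "norm (of_real (cleared_coeff y x (Suc m)) * z ^ Suc m) \<le> ?K * (1 / (49 * x\<^sup>2)) * (1 / 49) ^ m" for m
  proof (rule order_trans[OF cleared_term_bound mult_mono])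
    show "?K * norm z \<le> ?K * (1 / (49 * x\<^sup>2))" by (rule mult_left_mono[OF z K])
    show "(x\<^sup>2 * norm z) ^ m \<le> (1 / 49) ^ m" by (rule power_mono[OF r]) simp
    show "0 \<le> ?K * (1 / (49 * x\<^sup>2))" by (intro mult_nonneg_nonneg K) simp
  qed simp
  have g: "(\<lambda>m. ?K * (1 / (49 * x\<^sup>2)) * (1 / 49) ^ m) sums (?K * (1 / (49 * x\<^sup>2)) * (1 / (1 - 1 / 49)))"
    by (intro sums_mult geometric_sums) simp
  have "(\<lambda>m. of_real (cleared_coeff y x (Suc m)) * z ^ Suc m) sums (cleared_gen y x z - of_real (Delta y))"
    using cleared_gen_sums[of z] r
    by (subst sums_Suc_iff[of "\<lambda>m. of_real (cleared_coeff y x m) * z ^ m"]) (simp add: cleared_coeff_def)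
  hence "norm (cleared_gen y x z - of_real (Delta y)) \<le> ?K * (1 / (49 * x\<^sup>2)) * (1 / (1 - 1 / 49))"
    using norm_suminf_le[OF t sums_summable[OF g]] g by (simp add: sums_iff)
  also have "\<dots> = (1 + x) / 2 * (y\<^sup>2 / ((1 - y) * x))"
    using x y by (simp add: divide_simps power2_eq_square)
  finally show ?thesis .
qed

end

lemma cleared_gen_0: "cleared_gen y x 0 = of_real (Delta y)"
  by (simp add: cleared_gen_def powser_zero cleared_coeff_def)

text \<open>In the denominator \<open>Delta x\<close> is close to \<open>x\<close> while the
  deviation from it is only about \<open>x / 2\<close>, so a fixed fraction of \<open>x\<close>
  remains.\<close>

lemma cleared_ratio_bound:
  assumes q: "0 < q" "q < 1" and x: "0 < x" "x \<le> q" "x \<le> 1 / 1000"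
    and z: "norm z \<le> 1 / (49 * x\<^sup>2)"
  shows "cleared_gen x x z \<noteq> 0"
    and "norm (cleared_gen q x z / cleared_gen x x z) \<le> 4 * (q\<^sup>2 / x\<^sup>2) / (1 - q)"
proof -
  have x1: "x < 1" using x by simp
  have e: "x\<^sup>2 / ((1 - x) * x) = x / (1 - x)" using x x1 by (simp add: power2_eq_square)
  have "Delta x - norm (cleared_gen x x z) \<le> norm (cleared_gen x x z - of_real (Delta x))"
    using norm_triangle_ineq2[of "of_real (Delta x) :: complex" "cleared_gen x x z"] Delta_bounds(1)[of x] x x1
    by (simp add: norm_minus_commute)
  also have "\<dots> \<le> (1 + x) / 2 * (x / (1 - x))"
    using cleared_gen_bound[OF x(1) x1 x(1) x1 z] unfolding e .
  finally have "norm (cleared_gen x x z) \<ge> x - 24 * x\<^sup>2 / (1 - x) - (1 + x) / 2 * (x / (1 - x))"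
    using Delta_bounds(3)[of x] x x1 by linarith
  moreover have "x - 24 * x\<^sup>2 / (1 - x) - (1 + x) / 2 * (x / (1 - x)) = x * (1 - (24 * x + (1 + x) / 2) / (1 - x))"
    by (simp only: divide_inverse) (simp add: algebra_simps power2_eq_square)
  \<comment> \<open>For small \<open>x\<close> the left side is close to \<open>1 / 2\<close>;
    \<open>x <= 1 / 1000\<close> leaves room for \<open>55 / 100\<close>.\<close>
  moreover have "(24 * x + (1 + x) / 2) / (1 - x) \<le> 55 / 100"
  proof -
    have "24 * x + (1 + x) / 2 \<le> 55 / 100 * (1 - x)" using x(3) by (simp add: field_simps)
    thus ?thesis using x1 by (subst pos_divide_le_eq) auto
  qed
  hence "x * (45 / 100) \<le> x * (1 - (24 * x + (1 + x) / 2) / (1 - x))"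
    using x by (intro mult_left_mono) auto
  ultimately have den: "x * (45 / 100) \<le> norm (cleared_gen x x z)" by linarith
  thus nz: "cleared_gen x x z \<noteq> 0" using x by auto
  \<comment> \<open>The scale of the numerator's error; it dominates \<open>q\<close>, hence
    \<open>Delta q\<close>, because \<open>(1 - q) * x <= q\<close>.\<close>
  define E where "E = q\<^sup>2 / ((1 - q) * x)"
  have "(1 - q) * x \<le> 1 * q" using x q by (intro mult_mono) auto
  hence "q * ((1 - q) * x) \<le> q * q" using q by (intro mult_left_mono) auto
  hence qE: "q \<le> E" using x q by (simp add: E_def power2_eq_square le_divide_eq)
  have "norm (cleared_gen q x z) \<le> Delta q + norm (cleared_gen q x z - of_real (Delta q))"
    using norm_triangle_ineq[of "of_real (Delta q)" "cleared_gen q x z - of_real (Delta q)"] Delta_bounds(1)[of q] q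
    by simp
  also have "\<dots> \<le> q + (1 + x) / 2 * E"
    unfolding E_def using Delta_bounds(2)[of q] cleared_gen_bound[OF x(1) x1 q z] q by (intro add_mono) auto
  also have "\<dots> \<le> E + 6 / 10 * E"
    using qE x q by (intro add_mono mult_right_mono) auto
  finally have num: "norm (cleared_gen q x z) \<le> 16 / 10 * E" by simp
  have "norm (cleared_gen q x z / cleared_gen x x z) \<le> (16 / 10 * E) / (x * (45 / 100))"
    unfolding norm_divide using num den x q qE by (intro frac_le) auto
  \<comment> \<open>The quotient of \<open>16 / 10\<close> by \<open>45 / 100\<close> is
    \<open>32 / 9\<close>, below 4.\<close>
  also have "\<dots> \<le> 4 * (E / x)" using qE q x by (simp add: field_simps)
  also have "E / x = q\<^sup>2 / x\<^sup>2 / (1 - q)" by (simp add: E_def power2_eq_square field_simps)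
  finally show "norm (cleared_gen q x z / cleared_gen x x z) \<le> 4 * (q\<^sup>2 / x\<^sup>2) / (1 - q)" by simp
qed

section \<open>\<open>W\<close> and \<open>T\<close> at a real point\<close>

lemma W_num_eq_Delta_gen:
  assumes q: "0 < q" "q < 1"
  shows "W_num a z (of_real q) = Delta_gen q (q ^ a) z"
proof -
  have "z ^ m * of_real q ^ (a * m + 1) * Phi (of_real q ^ (a * m + 1)) ^ 24 =
     of_real (Delta (q * (q ^ a) ^ m)) * z ^ m" for m
  proof -
    have "0 < q ^ (a * m + 1)" "q ^ (a * m + 1) < 1" using q by (auto intro!: power_less_one_iff[THEN iffD2] simp del: power_Suc)
    from Phi_Delta[OF this] show ?thesis by (simp add: power_mult mult_ac)
  qed
  thus ?thesis by (simp only: W_num_def Delta_gen_def)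
qed

lemma W_den_eq_Delta_gen:
  assumes q: "0 < q" "q < 1" and a: "a > 0"
  shows "W_den a z (of_real q) = Delta_gen (q ^ a) (q ^ a) z"
proof -
  have "z ^ m * of_real q ^ (a * (m + 1)) * Phi (of_real q ^ (a * (m + 1))) ^ 24 =
     of_real (Delta (q ^ a * (q ^ a) ^ m)) * z ^ m" for m
  proof -
    have "0 < q ^ (a * (m + 1))" "q ^ (a * (m + 1)) < 1" using q a by (auto intro!: power_less_one_iff[THEN iffD2])
    from Phi_Delta[OF this] show ?thesis by (simp add: power_mult power_add mult_ac)
  qed
  thus ?thesis by (simp only: W_den_def Delta_gen_def)
qed

lemma T_eq_Delta:
  assumes q: "0 < q" "q < 1" and a: "a > 0"
  shows "T a (of_real q) = of_real (Delta q / Delta (q ^ a))"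
proof -
  have "q ^ a < 1" using q a by (simp add: power_less_one_iff)
  moreover have "(of_real q :: complex) powi (1 - int a) = of_real q / of_real q ^ a"
    using q by (simp add: power_int_diff)
  ultimately show ?thesis
    using q Phi_of_real[of q] Phi_of_real[of "q ^ a"] by (simp add: T_def Delta_def)
qed

lemma W_at_small_argument:
  assumes q: "0 < q" "q < 1" and a: "a > 0" and d: "d > 0" and small: "q ^ a \<le> 1 / 1000"
  shows "\<not> is_pole (W a d) (of_real q)"
    and "norm (W a d (of_real q) - T a (of_real q)) \<le>
      4 * (q\<^sup>2 / (q ^ a)\<^sup>2) / (1 - q) * ((49 * (q ^ a)\<^sup>2) ^ d / (1 - (49 * (q ^ a)\<^sup>2) ^ d))"
proof -
  define x where "x = q ^ a"
  have x: "0 < x" "x \<le> q" "x \<le> 1 / 1000" "x < 1"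
    using q a small power_decreasing[of 1 a q] by (auto simp: x_def)
  \<comment> \<open>\<open>1 / R\<close> is the base of the geometric decay in \<open>d\<close>, and
    becomes \<open>lam a\<close> at \<open>q_pt a\<close>.\<close>
  define R where "R = 1 / (49 * x\<^sup>2)"
  have "x\<^sup>2 \<le> (1 / 1000)\<^sup>2" using x by (intro power_mono) auto
  hence R: "1 < R" using x by (simp add: R_def power2_eq_square divide_simps)
  define F where "F z = cleared_gen q x z / cleared_gen x x z" for z
  have nz: "cleared_gen x x z \<noteq> 0" if "norm z \<le> R" for z
    using cleared_ratio_bound(1)[of q x z] q x that by (simp add: R_def)
  have unit: "norm z = 1" if "z ^ d = 1" for z :: complex using power_eq_1_iff[OF that] d by auto
  have den: "W_den a z (of_real q) \<noteq> 0" and ratio: "W_num a z (of_real q) / W_den a z (of_real q) = F z"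
    if "z ^ d = 1" for z
  proof -
    have z: "norm z \<le> 1" using unit[OF that] by simp
    have "norm (z * of_real x) < 1" using unit[OF that] x by (simp add: norm_mult)
    hence "1 - z * of_real x \<noteq> 0" by auto
    thus "W_den a z (of_real q) \<noteq> 0" "W_num a z (of_real q) / W_den a z (of_real q) = F z"
      using nz[of z] z R cleared_gen_eq[OF x(1,4) x(1,4) z] cleared_gen_eq[OF x(1,4) q z]
      by (auto simp: F_def W_num_eq_Delta_gen[OF q] W_den_eq_Delta_gen[OF q a] x_def[symmetric])
  qed
  define w where "w p = 1 / of_nat d * (\<Sum>z | z ^ d = 1. W_num a z p / W_den a z p)" for p
  have less: "m < a * m + 1" "m < a * (m + 1)" for m
    using a mult_le_mono1[of 1 a m] by (simp_all only: add_mult_distrib2) linarith+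
  have hol: "W_num a z analytic_on {of_real q}" "W_den a z analytic_on {of_real q}" if "z ^ d = 1" for z
  proof -
    have "W_num a z holomorphic_on ball 0 1" "W_den a z holomorphic_on ball 0 1"
      unfolding W_num_def W_den_def by (intro series_holomorphic unit[OF that] less)+
    thus "W_num a z analytic_on {of_real q}" "W_den a z analytic_on {of_real q}"
      using q by (auto simp: analytic_at intro!: exI[of _ "ball 0 1"])
  qed
  \<comment> \<open>No denominator vanishes at \<open>q\<close>, so \<open>remove_sings\<close>
    leaves the value of the bare average unchanged there.\<close>
  have an: "w analytic_on {of_real q}"
    unfolding w_def using den by (intro analytic_intros hol) auto
  have Ww: "W a d = remove_sings w" by (simp only: W_def w_def[abs_def])
  show "\<not> is_pole (W a d) (of_real q)"
    unfolding Ww by (intro analytic_at_imp_no_pole remove_sings_analytic_on an)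
  have val: "W a d (of_real q) = 1 / of_nat d * (\<Sum>z | z ^ d = 1. F z)"
    unfolding Ww remove_sings_at_analytic[OF an] w_def by (simp add: ratio)
  have T: "T a (of_real q) = F 0"
    by (simp add: T_eq_Delta[OF q a] F_def cleared_gen_0 x_def)
  have "1 / (49 * x\<^sup>2) < 1 / x\<^sup>2" using x by (simp add: divide_simps)
  hence sub: "cball 0 R \<subseteq> ball 0 (1 / x\<^sup>2)" by (auto simp: R_def)
  have hF: "F holomorphic_on cball 0 R"
    unfolding F_def using x q nz
    by (intro holomorphic_on_divide holomorphic_on_subset[OF cleared_gen_holomorphic sub]) auto
  have bd: "norm (F z) \<le> 4 * (q\<^sup>2 / x\<^sup>2) / (1 - q)" if "norm z = R" for z
    using cleared_ratio_bound(2)[OF q x(1-3)] that by (simp add: F_def R_def)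
  have "norm (W a d (of_real q) - T a (of_real q)) \<le> 4 * (q\<^sup>2 / x\<^sup>2) / (1 - q) * ((1 / R) ^ d / (1 - (1 / R) ^ d))"
    unfolding val T
    by (rule roots_unity_average_bound[OF R d holomorphic_on_subset[OF hF] holomorphic_on_imp_continuous_on[OF hF] bd]) auto
  thus "norm (W a d (of_real q) - T a (of_real q)) \<le>
      4 * (q\<^sup>2 / (q ^ a)\<^sup>2) / (1 - q) * ((49 * (q ^ a)\<^sup>2) ^ d / (1 - (49 * (q ^ a)\<^sup>2) ^ d))"
    by (simp add: R_def x_def)
qed

section \<open>The point \<open>q_a\<close>\<close>

text \<open>With \<open>t = sqrt a\<close>, the nomes \<open>q_pt a\<close> and
  \<open>q_pt a ^ a\<close> belong to \<open>i / t\<close> and \<open>i t\<close>, which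
  \<open>tau -> -1 / tau\<close> exchanges.\<close>

lemma q_pt_power: "a > 0 \<Longrightarrow> q_pt a ^ a = exp (- 2 * pi * sqrt (real a))"
proof -
  assume a: "a > 0"
  have "q_pt a ^ a = exp (real a * (- 2 * pi / sqrt (real a)))"
    by (simp only: q_pt_def exp_of_nat_mult)
  also have "real a * (- 2 * pi / sqrt (real a)) = - 2 * pi * (real a / sqrt (real a))" by simp
  also have "real a / sqrt (real a) = sqrt (real a)" by (rule real_div_sqrt) simp
  finally show ?thesis .
qed

lemma T_at_q_pt:
  assumes a: "a > 0"
  shows "T a (of_real (q_pt a)) = of_nat a ^ 6"
proof -
  define t where "t = sqrt (real a)"
  have t: "t > 0" using a by (simp add: t_def)
  have q: "0 < q_pt a" "q_pt a < 1" using a by (auto simp: q_pt_def)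
  have "Delta (q_pt a) / Delta (q_pt a ^ a) =
     exp (- 2 * pi / t) * exp (ln_Phi (exp (- 2 * pi / t))) ^ 24 / (exp (- 2 * pi * t) * exp (ln_Phi (exp (- 2 * pi * t))) ^ 24)"
    by (simp only: Delta_def q_pt_power[OF a]) (simp only: q_pt_def t_def)
  also have "\<dots> = exp ((- 2 * pi / t + 24 * ln_Phi (exp (- 2 * pi / t))) - (- 2 * pi * t + 24 * ln_Phi (exp (- 2 * pi * t))))"
    by (simp only: exp_diff exp_add exp_of_nat_mult[of 24, simplified])
  also have "(- 2 * pi / t + 24 * ln_Phi (exp (- 2 * pi / t))) - (- 2 * pi * t + 24 * ln_Phi (exp (- 2 * pi * t))) =
     - 2 * pi / t + 2 * pi * t + 24 * (ln_Phi (exp (- 2 * pi / t)) - ln_Phi (exp (- 2 * pi * t)))" by simp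
  \<comment> \<open>The term \<open>24 * pi / 12 * (1 / t - t)\<close> cancels the exponents of the
    leading factors of \<open>Delta\<close>.\<close>
  also have "\<dots> = real 12 * ln t"
    unfolding ln_Phi_modular[OF t] by (simp add: field_simps)
  also have "exp (real 12 * ln t) = t ^ 12" using t by (simp only: exp_of_nat_mult exp_ln)
  also have "\<dots> = (t ^ 2) ^ 6" by (simp add: power_mult[symmetric])
  also have "\<dots> = real a ^ 6" by (simp add: t_def)
  finally show ?thesis by (simp add: T_eq_Delta[OF q a])
qed

lemma exp_minus_two_pi_sqrt_le:
  assumes "a \<ge> 2"
  shows "exp (- 2 * pi * sqrt (real a)) \<le> 1 / 1000"
proof -
  have "1.4 \<le> sqrt (real a)" using assms by (intro real_le_rsqrt) (simp add: power2_eq_square)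
  hence "3 * 1.4 \<le> pi * sqrt (real a)" using pi_gt3 by (intro mult_mono) auto
  hence "8 \<le> 2 * pi * sqrt (real a)" by simp
  \<comment> \<open>The Taylor bound \<open>1 + 1 + 1 / 2 <= exp 1\<close> supplies
    \<open>5 / 2\<close>, whose eighth power exceeds 1500.\<close>
  have "(1000 :: real) \<le> (5 / 2) ^ 8" by (simp add: power_divide)
  also have "\<dots> \<le> exp 1 ^ 8" using exp_lower_Taylor_quadratic[of 1] by (intro power_mono) auto
  also have "\<dots> = exp (real 8 * 1)" by (simp only: exp_of_nat_mult)
  also have "\<dots> \<le> exp (2 * pi * sqrt (real a))" using \<open>8 \<le> _\<close> by simp
  finally show ?thesis by (simp add: exp_minus inverse_eq_divide divide_simps)
qed

theorem theorem6p1: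
  fixes a :: nat
  assumes "a \<ge> 2"
  shows "T a (of_real (q_pt a)) = of_nat a ^ 6
    \<and> (\<forall>d\<ge>2. \<not> is_pole (W a d) (of_real (q_pt a)))
    \<and> (\<forall>d\<ge>2. norm (W a d (of_real (q_pt a)) - of_nat a ^ 6)
          \<le> 4 * q_pt a powi (2 - 2 * int a) / (1 - q_pt a)
             * (lam a ^ d / (1 - lam a ^ d)))"
proof -
  have a: "a > 0" using assms by simp
  have q: "0 < q_pt a" "q_pt a < 1" using a by (auto simp: q_pt_def)
  have small: "q_pt a ^ a \<le> 1 / 1000"
    unfolding q_pt_power[OF a] by (rule exp_minus_two_pi_sqrt_le[OF assms])
  have "(q_pt a ^ a)\<^sup>2 = exp (- 4 * pi * sqrt (real a))"
    unfolding q_pt_power[OF a] by (simp flip: exp_double)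
  hence lam: "49 * (q_pt a ^ a)\<^sup>2 = lam a" by (simp add: lam_def)
  have "q_pt a powi (2 - 2 * int a) = q_pt a powi int 2 / q_pt a powi int (a * 2)"
    using q by (subst power_int_diff[symmetric]) (auto simp: mult.commute)
  hence powi: "q_pt a powi (2 - 2 * int a) = (q_pt a)\<^sup>2 / (q_pt a ^ a)\<^sup>2"
    by (simp only: power_int_of_nat power_mult)
  have "d > 0" if "d \<ge> 2" for d :: nat using that by simp
  note W = W_at_small_argument[OF q a this small]
  show ?thesis using W T_at_q_pt[OF a] unfolding lam powi by auto
qed

end
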